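(* Let $q=p^s$ with $p$ prime, let $a\in\mathbb{F}_q$ and $f=x^3+ax^2\in\mathbb{F}_q[x]$. Then (i) if $p\neq 3$, $v_0(f)=(q^2-1)/3$; (ii) if $p=3$ and $a\neq 0$, $v_0(f)=q^2/3$; (iii) if $p=3$ and $a=0$, $v_0(f)=q(q-1)/3$.
   Context: For $f\in\mathbb{F}_q[x]$, the non-hitting index $v_0(f)$ is the number of pairs $(c,d)\in\mathbb{F}_q^2$ such that the equation $f(x)-cx-d=0$ has no solution $x\in\mathbb{F}_q$. *)

theory Defs
  imports Complex_Main "HOL-Library.Cardinality"
    "HOL-Computational_Algebra.Polynomial" "HOL-Computational_Algebra.Primes"
begin

definition non_hitting_index :: "'a::{field,finite} poly \<Rightarrow> nat" where
  "non_hitting_index f = card {(c, d). \<not> (\<exists>x. poly f x - c * x - d = 0)}"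

end

theory Submission
  imports Defs
begin

text \<open>
  Count the lines \<open>d + c x\<close> by the number \<open>k\<close> of their intersections with the graph of \<open>f\<close>.
  As \<open>k \<le> 3\<close>, the indicator of \<open>k = 0\<close> is \<open>1 - k + k(k-1)/2 - k(k-1)(k-2)/6\<close>, so it suffices to
  sum the falling factorials of \<open>k\<close> over all lines. The first two sums are \<open>q\<^sup>2\<close> and \<open>q(q-1)\<close>,
  since each point lies on \<open>q\<close> non-vertical lines and each pair of distinct abscissae determines
  one line. The third sum counts the ordered triples of distinct elements with sum \<open>-a\<close>, because
  by Vieta three distinct abscissae belong to collinear points exactly when their sum is \<open>-a\<close>.
  Only this last count depends on the characteristic, through the solutions of \<open>3x = -a\<close>.
\<close>

text \<open>Double counting of incidences: it trades a sum over lines, where intersections are hard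
  to count, for a sum over points, pairs or triples, each lying on an easily counted set of
  lines.\<close>

lemma sum_card_swap:
  fixes Q :: "'b::finite \<Rightarrow> 'c::finite \<Rightarrow> bool"
  shows "(\<Sum>l\<in>UNIV. card {u. Q l u}) = (\<Sum>u\<in>UNIV. card {l. Q l u})"
proof -
  have "card {u. Q l u} = (\<Sum>u\<in>UNIV. if Q l u then 1 else 0)" for l
    by (simp add: sum.If_cases)
  moreover have "card {l. Q l u} = (\<Sum>l\<in>UNIV. if Q l u then 1 else 0)" for u
    by (simp add: sum.If_cases)
  ultimately show ?thesis
    using sum.swap by simp
qed

lemma card_distinct_pairs:
  assumes "finite R"
  shows "card {(x, y). x \<in> R \<and> y \<in> R \<and> x \<noteq> y} = card R * (card R - 1)"
proof -
  have "{(x, y). x \<in> R \<and> y \<in> R \<and> x \<noteq> y} = (SIGMA x:R. R - {x})"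
    by auto
  then show ?thesis
    using assms by simp
qed

lemma card_distinct_triples:
  assumes "finite R"
  shows "card {((x, y), z). x \<in> R \<and> y \<in> R \<and> x \<noteq> y \<and> z \<in> R \<and> z \<noteq> x \<and> z \<noteq> y}
    = card R * (card R - 1) * (card R - 2)"
proof -
  let ?P = "{(x, y). x \<in> R \<and> y \<in> R \<and> x \<noteq> y}"
  have "{((x, y), z). x \<in> R \<and> y \<in> R \<and> x \<noteq> y \<and> z \<in> R \<and> z \<noteq> x \<and> z \<noteq> y}
      = (SIGMA w:?P. R - {fst w, snd w})"
    by auto
  moreover have "finite ?P"
    by (rule finite_subset[of _ "R \<times> R"]) (use assms in auto)
  moreover have "card (R - {fst w, snd w}) = card R - 2" if "w \<in> ?P" for w
    using that assms by (subst card_Diff_subset) auto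
  ultimately show ?thesis
    using assms by (simp add: card_distinct_pairs)
qed

text \<open>Inclusion-exclusion multiplied by 6, with the negative terms moved across so that it
  holds in \<open>nat\<close>. Truncated subtraction is harmless: the products vanish for small
  \<open>k\<close> anyway.\<close>

lemma no_root_indicator:
  fixes k :: nat
  assumes "k \<le> 3"
  shows "6 * (if k = 0 then 1 else 0) + 6 * k + k * (k - 1) * (k - 2) = 6 + 3 * (k * (k - 1))"
proof -
  have "k = 0 \<or> k = 1 \<or> k = 2 \<or> k = 3"
    using assms by linarith
  then show ?thesis
    by auto
qed

lemma card_lines_through_point:
  fixes x t :: "'a::{field,finite}"
  shows "card {(c, d). t - c * x - d = 0} = CARD('a)"
proof -
  have "{(c, d). t - c * x - d = 0} = range (\<lambda>c. (c, t - c * x))"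
    by auto
  then show ?thesis
    by (simp add: card_image inj_on_def)
qed

lemma line_through_two_points:
  fixes x y s t :: "'a::field"
  assumes "x \<noteq> y"
  shows "{(c, d). s - c * x - d = 0 \<and> t - c * y - d = 0}
    = {((s - t) / (x - y), s - (s - t) / (x - y) * x)}"
proof -
  have "s - c * x - d = 0 \<and> t - c * y - d = 0 \<longleftrightarrow> c * (x - y) = s - t \<and> d = s - c * x" for c d
    by (auto simp: algebra_simps)
  moreover have "c * (x - y) = s - t \<longleftrightarrow> c = (s - t) / (x - y)" for c
    using assms by (simp add: eq_divide_eq)
  ultimately show ?thesis
    by (simp only:) auto
qed

lemma cubic_collinear_iff:
  fixes x y z a c d :: "'a::field"
  assumes "x \<noteq> y" "z \<noteq> x" "z \<noteq> y"
    and "x ^ 3 + a * x ^ 2 - c * x - d = 0" "y ^ 3 + a * y ^ 2 - c * y - d = 0"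
  shows "z ^ 3 + a * z ^ 2 - c * z - d = 0 \<longleftrightarrow> z = - a - x - y"
proof -
  have d: "d = x ^ 3 + a * x ^ 2 - c * x"
    using assms(4) by simp
  \<comment> \<open>The difference of the two root equations is divisible by \<open>x - y\<close>;
    cancelling this factor determines the slope \<open>c\<close>.\<close>
  have "(x - y) * (x ^ 2 + x * y + y ^ 2 + a * (x + y) - c) = 0"
    using assms(5) unfolding d by (simp add: algebra_simps power2_eq_square power3_eq_cube)
  then have c: "c = x ^ 2 + x * y + y ^ 2 + a * (x + y)"
    using assms(1) by simp
  \<comment> \<open>With \<open>c\<close> and \<open>d\<close> eliminated, the cubic splits, and its
    third root is read off from the last factor.\<close>
  have "z ^ 3 + a * z ^ 2 - c * z - d = (z - x) * (z - y) * (z + a + x + y)"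
    unfolding d c by algebra
  moreover have "z + a + x + y = 0 \<longleftrightarrow> z = - a - x - y"
    by (simp add: eq_diff_eq eq_neg_iff_add_eq_0 add_ac)
  ultimately show ?thesis
    using assms(2,3) by (metis mult_eq_0_iff right_minus_eq)
qed

text \<open>A triple of distinct abscissae lies on exactly one line if
  \<open>z = - a - x - y\<close> and on none otherwise, so the collinear triples correspond to their
  first two entries.\<close>

lemma sum_card_cubic_triples:
  fixes a :: "'a::{field,finite}"
  shows "(\<Sum>l\<in>UNIV. card {((x, y), z). x \<noteq> y \<and> z \<noteq> x \<and> z \<noteq> y \<and>
      x ^ 3 + a * x ^ 2 - fst l * x - snd l = 0 \<and> y ^ 3 + a * y ^ 2 - fst l * y - snd l = 0 \<and>
      z ^ 3 + a * z ^ 2 - fst l * z - snd l = 0})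
    = card {(x, y). x \<noteq> y \<and> - a - x - y \<noteq> x \<and> - a - x - y \<noteq> y}" (is "?L = card ?S")
proof -
  let ?r = "\<lambda>l x. x ^ 3 + a * x ^ 2 - fst l * x - snd l = 0"
  let ?Q = "\<lambda>l ((x, y), z). x \<noteq> y \<and> z \<noteq> x \<and> z \<noteq> y \<and> ?r l x \<and> ?r l y \<and> ?r l z"
  have *: "card {l. ?Q l w} = (if w \<in> (\<lambda>(x, y). ((x, y), - a - x - y)) ` ?S then 1 else 0)" for w
  proof -
    obtain x y z where w: "w = ((x, y), z)"
      by (metis prod.exhaust)
    show ?thesis
    proof (cases "w \<in> (\<lambda>(x, y). ((x, y), - a - x - y)) ` ?S")
      case True
      then have z: "x \<noteq> y" "z \<noteq> x" "z \<noteq> y" "z = - a - x - y"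
        using w by auto
      have eq: "{l. ?Q l w} = {(c, d).
        (x ^ 3 + a * x ^ 2) - c * x - d = 0 \<and> (y ^ 3 + a * y ^ 2) - c * y - d = 0}"
        using cubic_collinear_iff[OF z(1-3)] z unfolding w by auto
      show ?thesis
        using True unfolding eq line_through_two_points[OF z(1)] by simp
    next
      case False
      have "\<not> ?Q l w" for l
        using cubic_collinear_iff[of x y z a "fst l" "snd l"] False unfolding w by force
      then show ?thesis
        using False by simp
    qed
  qed
  have "?L = (\<Sum>w\<in>UNIV. card {l. ?Q l w})"
    by (rule sum_card_swap)
  also have "\<dots> = card ((\<lambda>(x, y). ((x, y), - a - x - y)) ` ?S)"
    unfolding * by (simp add: sum.If_cases)
  also have "\<dots> = card ?S"
    by (rule card_image) (auto simp: inj_on_def)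
  finally show ?thesis .
qed

lemma card_cubic_roots_le:
  fixes a c d :: "'a::field"
  shows "card {x. x ^ 3 + a * x ^ 2 - c * x - d = 0} \<le> 3"
proof -
  let ?p = "[:- d, - c, a, 1:]"
  have "{x. x ^ 3 + a * x ^ 2 - c * x - d = 0} = {x. poly ?p x = 0}"
    by (auto simp: algebra_simps power2_eq_square power3_eq_cube)
  then show ?thesis
    using card_poly_roots_bound[of ?p] by simp
qed

lemma non_hitting_index_cubic:
  fixes a :: "'a::{field,finite}"
  shows "6 * non_hitting_index (monom 1 3 + monom a 2)
      + card {(x, y). x \<noteq> y \<and> - a - x - y \<noteq> x \<and> - a - x - y \<noteq> y}
    = 3 * (CARD('a) * (CARD('a) - 1))"
proof -
  let ?r = "\<lambda>l x. x ^ 3 + a * x ^ 2 - fst l * x - snd l = 0"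
  define R where "R l = {x. ?r l x}" for l
  let ?k = "\<lambda>l. card (R l)"
  have "non_hitting_index (monom 1 3 + monom a 2) = card {l. ?k l = 0}"
    unfolding non_hitting_index_def R_def
    by (auto intro!: arg_cong[where f = card] simp: poly_monom case_prod_unfold)
  then have zero: "non_hitting_index (monom 1 3 + monom a 2) = (\<Sum>l\<in>UNIV. if ?k l = 0 then 1 else 0)"
    by (simp add: sum.If_cases)
  have "(\<Sum>l\<in>UNIV. ?k l) = (\<Sum>x\<in>UNIV. card {l. ?r l x})"
    unfolding R_def by (rule sum_card_swap)
  also have "\<dots> = (\<Sum>x\<in>UNIV. card {(c, d). (x ^ 3 + a * x ^ 2) - c * x - d = 0})"
    by (simp only: case_prod_unfold)
  also have "\<dots> = CARD('a) * CARD('a)"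
    by (simp only: card_lines_through_point) simp
  finally have one: "(\<Sum>l\<in>UNIV. ?k l) = CARD('a) * CARD('a)" .
  have line: "card {l. fst w \<noteq> snd w \<and> ?r l (fst w) \<and> ?r l (snd w)}
      = (if fst w \<noteq> snd w then 1 else 0)" for w
  proof (cases "fst w = snd w")
    case False
    then have eq: "{l. fst w \<noteq> snd w \<and> ?r l (fst w) \<and> ?r l (snd w)} = {(c, d).
        (fst w ^ 3 + a * fst w ^ 2) - c * fst w - d = 0 \<and>
        (snd w ^ 3 + a * snd w ^ 2) - c * snd w - d = 0}"
      by auto
    show ?thesis
      using False unfolding eq line_through_two_points[OF False] by simp
  qed simp
  have "?k l * (?k l - 1) = card {w. fst w \<noteq> snd w \<and> ?r l (fst w) \<and> ?r l (snd w)}" for l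
    using card_distinct_pairs[of "R l"]
    by (simp add: R_def case_prod_unfold conj_ac)
  then have "(\<Sum>l\<in>UNIV. ?k l * (?k l - 1))
      = (\<Sum>w\<in>UNIV. card {l. fst w \<noteq> snd w \<and> ?r l (fst w) \<and> ?r l (snd w)})"
    by (simp only:) (rule sum_card_swap)
  also have "\<dots> = card {w :: 'a \<times> 'a. fst w \<noteq> snd w}"
    unfolding line by (simp add: sum.If_cases)
  also have "\<dots> = CARD('a) * (CARD('a) - 1)"
    using card_distinct_pairs[of "UNIV :: 'a set"] by (simp add: case_prod_unfold)
  finally have two: "(\<Sum>l\<in>UNIV. ?k l * (?k l - 1)) = CARD('a) * (CARD('a) - 1)" .
  have "?k l * (?k l - 1) * (?k l - 2) = card {((x, y), z). x \<noteq> y \<and> z \<noteq> x \<and> z \<noteq> y \<and>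
      ?r l x \<and> ?r l y \<and> ?r l z}" for l
    unfolding card_distinct_triples[of "R l", OF finite, symmetric]
    by (rule arg_cong[where f = card]) (auto simp: R_def)
  then have three: "(\<Sum>l\<in>UNIV. ?k l * (?k l - 1) * (?k l - 2))
      = card {(x, y). x \<noteq> y \<and> - a - x - y \<noteq> x \<and> - a - x - y \<noteq> y}"
    by (simp only: sum_card_cubic_triples)
  have "?k l \<le> 3" for l
    unfolding R_def by (rule card_cubic_roots_le)
  then have "(\<Sum>l\<in>UNIV. 6 * (if ?k l = 0 then 1 else 0) + 6 * ?k l + ?k l * (?k l - 1) * (?k l - 2))
      = (\<Sum>l\<in>UNIV. 6 + 3 * (?k l * (?k l - 1)))"
    by (intro sum.cong refl no_root_indicator)
  \<comment> \<open>After substituting the three sums, the constant term cancels against the first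
    moment, both being six times the square of \<open>CARD('a)\<close>.\<close>
  then have "6 * (\<Sum>l\<in>UNIV. if ?k l = 0 then 1 else 0) + 6 * (\<Sum>l\<in>UNIV. ?k l)
      + (\<Sum>l\<in>UNIV. ?k l * (?k l - 1) * (?k l - 2))
      = 6 * CARD('a \<times> 'a) + 3 * (\<Sum>l\<in>UNIV. ?k l * (?k l - 1))"
    unfolding sum.distrib sum_distrib_left by simp
  then show ?thesis
    unfolding zero[symmetric] one two three by simp
qed

text \<open>From the pairs with \<open>x \<noteq> y\<close>, remove those whose third root repeats
  \<open>x\<close> (the set \<open>A\<close>) or \<open>y\<close> (the set \<open>B\<close>). Each
  is parametrised by its repeated root, which may be any \<open>x\<close> with
  \<open>3 * x \<noteq> - a\<close>.\<close>

lemma card_distinct_sum_pairs: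
  fixes a :: "'a::{field,finite}"
  shows "card {(x, y). x \<noteq> y \<and> - a - x - y \<noteq> x \<and> - a - x - y \<noteq> y}
      + 2 * card {x. 3 * x \<noteq> - a} = CARD('a) * (CARD('a) - 1)"
proof -
  let ?S = "{(x, y). x \<noteq> y \<and> - a - x - y \<noteq> x \<and> - a - x - y \<noteq> y}"
  let ?N = "{x. 3 * x \<noteq> - a}"
  define A B where "A = (\<lambda>x. (x, - a - 2 * x)) ` ?N" and "B = (\<lambda>x. (- a - 2 * x, x)) ` ?N"
  have 3: "x = - a - 2 * x \<longleftrightarrow> 3 * x = - a" for x :: 'a
    by (auto simp: algebra_simps; algebra)
  have mem_A: "(x, y) \<in> A \<longleftrightarrow> x \<noteq> y \<and> - a - x - y = x" for x y
    using 3[of x] by (auto simp: A_def algebra_simps)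
  have mem_B: "(x, y) \<in> B \<longleftrightarrow> x \<noteq> y \<and> - a - x - y = y" for x y
    using 3[of y] by (auto simp: B_def algebra_simps)
  have "{(x, y). x \<noteq> y} = ?S \<union> (A \<union> B)"
    using mem_A mem_B by (intro set_eqI) auto
  moreover have "?S \<inter> (A \<union> B) = {}"
    using mem_A mem_B by auto
  \<comment> \<open>A third root equal to both entries would force \<open>x = y\<close>.\<close>
  moreover have "A \<inter> B = {}"
    using mem_A mem_B by (metis disjoint_iff surj_pair)
  moreover have "card A = card ?N" "card B = card ?N"
    unfolding A_def B_def by (rule card_image, auto simp: inj_on_def)+
  ultimately have "card {(x :: 'a, y). x \<noteq> y} = card ?S + (card ?N + card ?N)"
    by (simp add: card_Un_disjoint)
  then show ?thesis
    using card_distinct_pairs[of "UNIV :: 'a set"] by simp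
qed

text \<open>Translation by 1 permutes the ring, so adding 1 to every element leaves the total sum
  unchanged.\<close>

lemma of_nat_CARD_eq_0: "of_nat CARD('a) = (0 :: 'a::{ring_1,finite})"
proof -
  have "bij (\<lambda>x :: 'a. x + 1)"
    by (rule bij_betw_byWitness[where f' = "\<lambda>x. x - 1"]) auto
  then have "(\<Sum>x\<in>UNIV. x + 1) = (\<Sum>x\<in>UNIV. x :: 'a)"
    by (rule sum.reindex_bij_betw)
  then show ?thesis
    by (simp add: sum.distrib)
qed

lemma three_eq_0_iff:
  assumes "prime p" "CARD('a::{field,finite}) = p ^ s"
  shows "(3 :: 'a) = 0 \<longleftrightarrow> p = 3"
proof -
  have "of_nat (p ^ s) = (0 :: 'a)"
    using of_nat_CARD_eq_0[where 'a = 'a] assms(2) by simp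
  \<comment> \<open>A field has no nonzero nilpotents, so the vanishing of \<open>p ^ s\<close>
    forces that of \<open>p\<close>.\<close>
  then have "CHAR('a) dvd p"
    by (auto simp flip: of_nat_eq_0_iff_char_dvd)
  then have "CHAR('a) = p"
    using assms(1) prime_nat_iff CHAR_not_1[where 'a = 'a] by auto
  moreover have "(3 :: 'a) = 0 \<longleftrightarrow> CHAR('a) dvd 3"
    using of_nat_eq_0_iff_char_dvd[of 3, where 'a = 'a] by simp
  moreover have "p dvd 3 \<longleftrightarrow> p = 3"
    using assms(1) primes_dvd_imp_eq[of p 3] by auto
  ultimately show ?thesis
    by simp
qed

theorem theorem4p22:
  fixes p s q :: nat and a :: "'a::{field,finite}" and f :: "'a poly"
  assumes "prime p" and "q = p ^ s" and "CARD('a) = q"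
    and "f = monom 1 3 + monom a 2"
  shows "(p \<noteq> 3 \<longrightarrow> real (non_hitting_index f) = (real q ^ 2 - 1) / 3) \<and>
    (p = 3 \<and> a \<noteq> 0 \<longrightarrow> real (non_hitting_index f) = real q ^ 2 / 3) \<and>
    (p = 3 \<and> a = 0 \<longrightarrow> real (non_hitting_index f) = real q * (real q - 1) / 3)"
proof -
  define n where "n = card {x :: 'a. 3 * x \<noteq> - a}"
  have q: "q \<ge> 1"
    using assms(3) by (metis One_nat_def Suc_leI zero_less_card_finite)
  \<comment> \<open>Adding the two counts eliminates the number of collinear triples; the case
    distinction now rests on \<open>n\<close> alone.\<close>
  have "6 * non_hitting_index f + q * (q - 1) = 3 * (q * (q - 1)) + 2 * n"
    using non_hitting_index_cubic[of a] card_distinct_sum_pairs[of a] assms(3,4)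
    unfolding n_def by simp
  then have "3 * non_hitting_index f = q * (q - 1) + n"
    by simp
  then have "real (3 * non_hitting_index f) = real (q * (q - 1) + n)"
    by (rule arg_cong)
  then have main: "real (non_hitting_index f) = (real q * (real q - 1) + real n) / 3"
    using q by (simp add: of_nat_diff)
  have char: "(3 :: 'a) = 0 \<longleftrightarrow> p = 3"
    using three_eq_0_iff assms by blast
  \<comment> \<open>If 3 is invertible, \<open>3 * x = - a\<close> has one solution; in
    characteristic 3 it has none or all of the field, according to whether \<open>a\<close> is
    nonzero.\<close>
  have "n = q - 1" if "p \<noteq> 3"
  proof -
    have "{x :: 'a. 3 * x \<noteq> - a} = UNIV - {- a / 3}"
      using that char by (auto simp: field_simps)
    then show ?thesis
      using assms(3) by (simp add: n_def)
  qed
  moreover have "n = q" if "p = 3" "a \<noteq> 0"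
    using that char assms(3) by (simp add: n_def)
  moreover have "n = 0" if "p = 3" "a = 0"
    using that char by (simp add: n_def)
  ultimately show ?thesis
    unfolding main using q by (auto simp: of_nat_diff power2_eq_square algebra_simps)
qed

end
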